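(* Let $\mu\in\mathbb{R}$, $\sigma>0$, $\alpha\in\mathbb{R}$ and $\boldsymbol{\theta}=(\mu,\sigma,\alpha)$. Let $Z_{\mu,\sigma^2}$ be a normal random variable with expected value $\mu$ and variance $\sigma^2$, and let $W$ be a random variable, independent of $Z_{\mu,\sigma^2}$, such that $W=\alpha\sigma$ or $W=-\alpha\sigma$, each with probability $1/2$. If $X=Z_{\mu,\sigma^2}+W$, then $X\sim\text{BN}(\boldsymbol{\theta})$. Conversely, if $X\sim\text{BN}(\boldsymbol{\theta})$, then $X=Z_{\mu,\sigma^2}+W$ in distribution.
   Context: For $\boldsymbol{\theta}=(\mu,\sigma,\alpha)$, $\mu\in\mathbb{R}$, $\sigma>0$, $\alpha\in\mathbb{R}$, $X\sim\text{BN}(\boldsymbol{\theta})$ means that $X$ is a real random variable with PDF $$f(x;\boldsymbol{\theta})=\frac{1}{\sqrt{2\pi\sigma^2}}\exp\left[-\frac12\left(\frac{x-\mu}{\sigma}\right)^2-\frac{\alpha^2}{2}\right]\cosh\left[\alpha\left(\frac{x-\mu}{\sigma}\right)\right],\quad x\in\mathbb{R}.$$ *)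

theory Defs
  imports "HOL-Probability.Probability"
begin

definition bn_density :: "real \<Rightarrow> real \<Rightarrow> real \<Rightarrow> real \<Rightarrow> real" where
  "bn_density \<mu> \<sigma> \<alpha> x =
     1 / sqrt (2 * pi * \<sigma>\<^sup>2) * exp (- (1 / 2) * ((x - \<mu>) / \<sigma>)\<^sup>2 - \<alpha>\<^sup>2 / 2)
       * cosh (\<alpha> * ((x - \<mu>) / \<sigma>))"

definition BN_distributed ::
    "'a measure \<Rightarrow> ('a \<Rightarrow> real) \<Rightarrow> real \<Rightarrow> real \<Rightarrow> real \<Rightarrow> bool" where
  "BN_distributed M X \<mu> \<sigma> \<alpha> \<longleftrightarrow>
     prob_space M \<and> distributed M lborel X (\<lambda>x. ennreal (bn_density \<mu> \<sigma> \<alpha> x))"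

(* W takes the values a and -a with probability 1/2 each.  This is stated through the law of W
   (the image of a fair coin) because for a = 0 the two values coincide: W is then 0 almost
   surely, whereas the conditions P(W = a) = 1/2 and P(W = -a) = 1/2 would be unsatisfied. *)
definition fair_sign_distributed :: "'a measure \<Rightarrow> ('a \<Rightarrow> real) \<Rightarrow> real \<Rightarrow> bool" where
  "fair_sign_distributed M W a \<longleftrightarrow>
     W \<in> borel_measurable M \<and>
     distr M borel W =
       distr (measure_pmf (bernoulli_pmf (1 / 2))) borel (\<lambda>b. if b then a else - a)"

end

theory Submission
  imports Defs
begin

text \<open>Conditioning on the sign of \<open>W\<close> makes the law of \<open>Z + W\<close> the equal mixture of the normal laws with
  means \<open>\<mu> \<plusminus> \<alpha>\<sigma>\<close> and variance \<open>\<sigma>\<^sup>2\<close>; completing the square, the two exponentials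
  combine to the hyperbolic cosine of the bimodal normal density.\<close>

lemma bn_density_eq_normal_mixture:
  assumes "\<sigma> > 0"
  shows "bn_density \<mu> \<sigma> \<alpha> x =
    (normal_density \<mu> \<sigma> (x - \<alpha> * \<sigma>) + normal_density \<mu> \<sigma> (x + \<alpha> * \<sigma>)) / 2"
proof -
  define t where "t = (x - \<mu>) / \<sigma>"
  have x: "x = \<mu> + \<sigma> * t" using assms by (simp add: t_def)
  \<comment> \<open>Here \<open>s\<close> is a sign, so one completed square serves both means:
    \<open>s = -1\<close> for the mean \<mu> + \<alpha>\<sigma> and \<open>s = 1\<close> for \<mu> -
    \<alpha>\<sigma>. Only the linear term depends on the sign.\<close>
  have exponent: "- (\<sigma> * t + s * (\<alpha> * \<sigma>))\<^sup>2 / (2 * \<sigma>\<^sup>2)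
      = (- (1 / 2) * t\<^sup>2 - \<alpha>\<^sup>2 / 2) + - s * (\<alpha> * t)" if "s\<^sup>2 = 1" for s
  proof -
    have "(\<sigma> * t + s * (\<alpha> * \<sigma>))\<^sup>2 = \<sigma>\<^sup>2 * (t\<^sup>2 + 2 * s * \<alpha> * t + \<alpha>\<^sup>2 * s\<^sup>2)"
      by (simp add: power2_eq_square algebra_simps)
    then show ?thesis using assms that by (simp add: field_simps)
  qed
  have "normal_density \<mu> \<sigma> (x - \<alpha> * \<sigma>) =
      1 / sqrt (2 * pi * \<sigma>\<^sup>2) * (exp (- (1 / 2) * t\<^sup>2 - \<alpha>\<^sup>2 / 2) * exp (\<alpha> * t))"
    using exponent[of "-1"] by (simp add: normal_density_def x flip: exp_add)
  moreover have "normal_density \<mu> \<sigma> (x + \<alpha> * \<sigma>) =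
      1 / sqrt (2 * pi * \<sigma>\<^sup>2) * (exp (- (1 / 2) * t\<^sup>2 - \<alpha>\<^sup>2 / 2) * exp (- (\<alpha> * t)))"
    using exponent[of 1] by (simp add: normal_density_def x flip: exp_add)
  ultimately show ?thesis
    by (simp add: bn_density_def cosh_field_def algebra_simps add_divide_distrib flip: t_def)
qed

lemma borel_measurable_bn_density [measurable]: "bn_density \<mu> \<sigma> \<alpha> \<in> borel_measurable borel"
  unfolding bn_density_def[abs_def] cosh_field_def by measurable

text \<open>Pulling the integral back to the coin leaves a sum over two outcomes. For
  \<open>a = 0\<close> the two halves add up to \<open>f 0\<close>, so no case distinction arises.
  The integral is over the law of \<open>W\<close> because that is the form in which convolution
  presents it.\<close>

lemma nn_integral_fair_sign_distributed:
  fixes f :: "real \<Rightarrow> ennreal"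
  assumes "fair_sign_distributed M W a" and [measurable]: "f \<in> borel_measurable borel"
  shows "(\<integral>\<^sup>+w. f w \<partial>distr M borel W) = f a / 2 + f (- a) / 2"
proof -
  have "(\<integral>\<^sup>+w. f w \<partial>distr M borel W) =
      (\<integral>\<^sup>+b. f (if b then a else - a) \<partial>measure_pmf (bernoulli_pmf (1 / 2)))"
    using assms by (simp add: fair_sign_distributed_def nn_integral_distr)
  also have "\<dots> = f a / 2 + f (- a) / 2"
    by (simp add: divide_ennreal_def)
  finally show ?thesis .
qed

text \<open>By independence the law of the sum is the convolution of the two laws. Averaging over
  \<open>W\<close> first turns it into half the sum of two translates of the normal law.\<close>

lemma (in prob_space) distr_normal_plus_fair_sign:
  assumes \<sigma>: "\<sigma> > 0"
    and Z: "distributed M lborel Z (normal_density \<mu> \<sigma>)"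
    and W: "fair_sign_distributed M W (\<alpha> * \<sigma>)"
    and indep: "indep_var borel Z borel W"
  shows "distr M borel (\<lambda>\<omega>. Z \<omega> + W \<omega>) = density lborel (bn_density \<mu> \<sigma> \<alpha>)"
proof (rule measure_eqI)
  fix A :: "real set"
  assume "A \<in> sets (distr M borel (\<lambda>\<omega>. Z \<omega> + W \<omega>))"
  then have [measurable]: "A \<in> sets borel" by simp
  have [measurable]: "Z \<in> borel_measurable M" "W \<in> borel_measurable M"
    using indep_var_rv1[OF indep] indep_var_rv2[OF indep] .
  \<comment> \<open>\<open>distributed\<close> speaks of \<open>lborel\<close>, the convolution of
    \<open>borel\<close>; both have the same sets, so \<open>distr_cong\<close> exchanges
    them.\<close>
  have law_Z: "distr M borel Z = density lborel (normal_density \<mu> \<sigma>)"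
    using distributed_distr_eq_density[OF Z] by (simp cong: distr_cong)
  \<comment> \<open>Translation invariance of Lebesgue measure: substituting
    \<open>z = x - w\<close> moves the shift from the set to the density.\<close>
  have shift: "(\<integral>\<^sup>+z. ennreal (normal_density \<mu> \<sigma> z) * indicator A (z + w) \<partial>lborel) =
      (\<integral>\<^sup>+x. ennreal (normal_density \<mu> \<sigma> (x - w)) * indicator A x \<partial>lborel)" for w
    by (subst nn_integral_real_affine[where c = 1 and t = "- w"]) auto
  interpret PZ: prob_space "distr M borel Z" by (rule prob_space_distr) simp
  interpret PW: prob_space "distr M borel W" by (rule prob_space_distr) simp
  have "emeasure (distr M borel (\<lambda>\<omega>. Z \<omega> + W \<omega>)) A =
      (\<integral>\<^sup>+z. \<integral>\<^sup>+w. indicator A (z + w) \<partial>distr M borel W \<partial>distr M borel Z)"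
    unfolding sum_indep_random_variable[OF indep \<open>Z \<in> borel_measurable M\<close> \<open>W \<in> borel_measurable M\<close>]
    by (subst convolution_emeasure') (auto simp: PZ.finite_measure_axioms PW.finite_measure_axioms)
  also have "\<dots> = (\<integral>\<^sup>+z. indicator A (z + \<alpha> * \<sigma>) / 2 + indicator A (z + - (\<alpha> * \<sigma>)) / 2
      \<partial>distr M borel Z)"
    by (subst nn_integral_fair_sign_distributed[OF W]) simp_all
  also have "\<dots> = (\<integral>\<^sup>+z. ennreal (normal_density \<mu> \<sigma> z) * indicator A (z + \<alpha> * \<sigma>) / 2
      + ennreal (normal_density \<mu> \<sigma> z) * indicator A (z + - (\<alpha> * \<sigma>)) / 2 \<partial>lborel)"
    unfolding law_Z by (simp add: nn_integral_density distrib_left ennreal_times_divide)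
  also have "\<dots> = (\<integral>\<^sup>+x. ennreal (normal_density \<mu> \<sigma> (x - \<alpha> * \<sigma>)) * indicator A x \<partial>lborel) / 2
      + (\<integral>\<^sup>+x. ennreal (normal_density \<mu> \<sigma> (x + \<alpha> * \<sigma>)) * indicator A x \<partial>lborel) / 2"
    using shift[of "\<alpha> * \<sigma>"] shift[of "- (\<alpha> * \<sigma>)"]
    by (simp add: nn_integral_add nn_integral_divide)
  also have "\<dots> = (\<integral>\<^sup>+x. (ennreal (normal_density \<mu> \<sigma> (x - \<alpha> * \<sigma>)) / 2
      + ennreal (normal_density \<mu> \<sigma> (x + \<alpha> * \<sigma>)) / 2) * indicator A x \<partial>lborel)"
    by (simp add: distrib_right nn_integral_add nn_integral_divide ennreal_divide_times
        ennreal_times_divide)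
  also have "\<dots> = (\<integral>\<^sup>+x. ennreal (bn_density \<mu> \<sigma> \<alpha> x) * indicator A x \<partial>lborel)"
    \<comment> \<open>The real mixture identity passes to \<open>ennreal\<close> because both normal
      densities are nonnegative.\<close>
    by (simp add: bn_density_eq_normal_mixture[OF \<sigma>] add_divide_distrib ennreal_plus
        flip: ennreal_divide_numeral)
  also have "\<dots> = emeasure (density lborel (bn_density \<mu> \<sigma> \<alpha>)) A"
    by (simp add: emeasure_density)
  finally show "emeasure (distr M borel (\<lambda>\<omega>. Z \<omega> + W \<omega>)) A =
      emeasure (density lborel (bn_density \<mu> \<sigma> \<alpha>)) A" .
qed simp

text \<open>Both directions compare \<open>X\<close> with the single law computed above. In the
  converse \<open>X\<close> may live on another space \<open>N\<close>, since equality in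
  distribution needs no common probability space.\<close>

theorem proposition4p1:
  fixes \<mu> \<sigma> \<alpha> :: real
    and M :: "'a measure" and Z W :: "'a \<Rightarrow> real"
  assumes "\<sigma> > 0"
    and "prob_space M"
    and "distributed M lborel Z (\<lambda>x. ennreal (normal_density \<mu> \<sigma> x))"
    and "fair_sign_distributed M W (\<alpha> * \<sigma>)"
    and "prob_space.indep_var M borel Z borel W"
  shows "(\<forall>X :: 'a \<Rightarrow> real.
            (\<forall>\<omega>\<in>space M. X \<omega> = Z \<omega> + W \<omega>) \<longrightarrow> BN_distributed M X \<mu> \<sigma> \<alpha>)
       \<and> (\<forall>(N :: 'b measure) (X :: 'b \<Rightarrow> real).
            BN_distributed N X \<mu> \<sigma> \<alpha> \<longrightarrow>
            distr N borel X = distr M borel (\<lambda>\<omega>. Z \<omega> + W \<omega>))"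
proof (intro conjI allI impI)
  interpret prob_space M by fact
  note law = distr_normal_plus_fair_sign[OF assms(1,3,4,5)]
  have [measurable]: "Z \<in> borel_measurable M" "W \<in> borel_measurable M"
    using indep_var_rv1[OF assms(5)] indep_var_rv2[OF assms(5)] .
  {
    fix X :: "'a \<Rightarrow> real"
    assume X: "\<forall>\<omega>\<in>space M. X \<omega> = Z \<omega> + W \<omega>"
    then have [measurable]: "X \<in> borel_measurable M"
      by (subst measurable_cong[where g = "\<lambda>\<omega>. Z \<omega> + W \<omega>"]) auto
    \<comment> \<open>Agreement on \<open>space M\<close> is all that an image measure sees.\<close>
    have "distr M lborel X = distr M borel (\<lambda>\<omega>. Z \<omega> + W \<omega>)"
      using X by (intro distr_cong) auto
    then show "BN_distributed M X \<mu> \<sigma> \<alpha>"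
      by (simp add: BN_distributed_def distributed_def law prob_space_axioms)
  next
    fix N :: "'b measure" and X :: "'b \<Rightarrow> real"
    assume "BN_distributed N X \<mu> \<sigma> \<alpha>"
    then have "distr N lborel X = density lborel (bn_density \<mu> \<sigma> \<alpha>)"
      by (simp add: BN_distributed_def distributed_distr_eq_density)
    then show "distr N borel X = distr M borel (\<lambda>\<omega>. Z \<omega> + W \<omega>)"
      by (simp add: law cong: distr_cong)
  }
qed

end
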